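(* (a) There are linear maps $0 \leq T \leq_c S$ acting on $M_2$ such that $S$ is completely positive, but $T$ is not $2$-positive. (b) There are linear maps $0 \leq T \leq_c S$ acting on $M_3$ such that $S$ is completely positive, but $T$ is not decomposable.
   Context: $M_n$ is the algebra of complex $n\times n$ matrices. $T\ge0$ means that $T$ maps positive (semidefinite) matrices to positive matrices. A map $T$ is $2$-positive if $I_{M_2}\otimes T\ge0$, and completely positive if $I_{M_n}\otimes T\ge0$ for every $n$. $T\le_c S$ means that $S-T$ is completely positive. A linear map on $M_n$ is decomposable if it is the sum of a completely positive map and a map of the form $a\mapsto \Phi(a^t)$ with $\Phi$ completely positive, where $a^t$ is the transpose of $a$. *)

theory Defs
  imports "Jordan_Normal_Form.Matrix" "HOL-Library.FuncSet"
begin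

text \<open>
  A map on the algebra of complex \<open>n \<times> n\<close> matrices is a HOL function on \<^typ>\<open>complex mat\<close> of
  which only the values on \<open>carrier_mat n n\<close> are relevant.
\<close>

definition linear_on_mat :: "nat \<Rightarrow> (complex mat \<Rightarrow> complex mat) \<Rightarrow> bool" where
  "linear_on_mat n T \<longleftrightarrow>
     T \<in> carrier_mat n n \<rightarrow> carrier_mat n n \<and>
     (\<forall>A\<in>carrier_mat n n. \<forall>B\<in>carrier_mat n n. T (A + B) = T A + T B) \<and>
     (\<forall>c. \<forall>A\<in>carrier_mat n n. T (c \<cdot>\<^sub>m A) = c \<cdot>\<^sub>m T A)"

text \<open>
  In the order on \<^typ>\<open>complex\<close>, \<open>0 \<le> z\<close> means that \<open>z\<close> is real and nonnegative, so the condition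
  below includes that \<open>A\<close> is Hermitian.
\<close>

definition positive_mat :: "nat \<Rightarrow> complex mat \<Rightarrow> bool" where
  "positive_mat n A \<longleftrightarrow>
     A \<in> carrier_mat n n \<and> (\<forall>v\<in>carrier_vec n. 0 \<le> (A *\<^sub>v v) \<bullet>c v)"

definition positive_map :: "nat \<Rightarrow> (complex mat \<Rightarrow> complex mat) \<Rightarrow> bool" where
  "positive_map n T \<longleftrightarrow> (\<forall>A. positive_mat n A \<longrightarrow> positive_mat n (T A))"

text \<open>
  \<open>M\<^sub>k \<otimes> M\<^sub>n\<close> is identified with the \<open>kn \<times> kn\<close> matrices, viewed as \<open>k \<times> k\<close> matrices of
  \<open>n \<times> n\<close> blocks; under this identification \<open>I \<otimes> T\<close> applies \<open>T\<close> to each block. The lemma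
  \<open>amplify_kron\<close> confirms this on elementary tensors.
\<close>

definition mat_block :: "nat \<Rightarrow> complex mat \<Rightarrow> nat \<Rightarrow> nat \<Rightarrow> complex mat" where
  "mat_block n A p q = mat n n (\<lambda>(i, j). A $$ (p * n + i, q * n + j))"

definition amplify ::
  "nat \<Rightarrow> nat \<Rightarrow> (complex mat \<Rightarrow> complex mat) \<Rightarrow> complex mat \<Rightarrow> complex mat" where
  "amplify k n T A =
     mat (k * n) (k * n) (\<lambda>(i, j). T (mat_block n A (i div n) (j div n)) $$ (i mod n, j mod n))"

definition kron :: "nat \<Rightarrow> nat \<Rightarrow> complex mat \<Rightarrow> complex mat \<Rightarrow> complex mat" where
  "kron k n E A = mat (k * n) (k * n) (\<lambda>(i, j). E $$ (i div n, j div n) * A $$ (i mod n, j mod n))"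

lemma amplify_kron:
  assumes T: "linear_on_mat n T" and A: "A \<in> carrier_mat n n"
  shows "amplify k n T (kron k n E A) = kron k n E (T A)"
proof -
  have blk: "mat_block n (kron k n E A) p q = E $$ (p, q) \<cdot>\<^sub>m A" if "p < k" "q < k" for p q
  proof -
    have "p * n + i < k * n" if "i < n" "p < k" for i p
    proof -
      have "p * n + i < Suc p * n" using that by simp
      also have "\<dots> \<le> k * n" using that by (intro mult_le_mono1) simp
      finally show ?thesis .
    qed
    then show ?thesis
      using that A by (intro eq_matI) (auto simp: mat_block_def kron_def)
  qed
  have TA: "T A \<in> carrier_mat n n" "\<And>c. T (c \<cdot>\<^sub>m A) = c \<cdot>\<^sub>m T A"
    using T A by (auto simp: linear_on_mat_def)
  have "T (mat_block n (kron k n E A) (i div n) (j div n)) $$ (i mod n, j mod n)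
        = E $$ (i div n, j div n) * T A $$ (i mod n, j mod n)"
    if "i < k * n" "j < k * n" for i j
  proof -
    have "0 < n" using that by (cases n) auto
    then show ?thesis
      using that TA by (simp add: blk less_mult_imp_div_less)
  qed
  then show ?thesis
    by (intro eq_matI) (auto simp: amplify_def kron_def)
qed

definition k_positive_map :: "nat \<Rightarrow> nat \<Rightarrow> (complex mat \<Rightarrow> complex mat) \<Rightarrow> bool" where
  "k_positive_map k n T \<longleftrightarrow> positive_map (k * n) (amplify k n T)"

definition completely_positive_map :: "nat \<Rightarrow> (complex mat \<Rightarrow> complex mat) \<Rightarrow> bool" where
  "completely_positive_map n T \<longleftrightarrow> (\<forall>k. k_positive_map k n T)"

definition cp_le :: "nat \<Rightarrow> (complex mat \<Rightarrow> complex mat) \<Rightarrow> (complex mat \<Rightarrow> complex mat) \<Rightarrow> bool" where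
  "cp_le n T S \<longleftrightarrow> completely_positive_map n (\<lambda>A. S A - T A)"

definition decomposable_map :: "nat \<Rightarrow> (complex mat \<Rightarrow> complex mat) \<Rightarrow> bool" where
  "decomposable_map n T \<longleftrightarrow>
     (\<exists>\<Phi> \<Psi>. linear_on_mat n \<Phi> \<and> completely_positive_map n \<Phi> \<and>
            linear_on_mat n \<Psi> \<and> completely_positive_map n \<Psi> \<and>
            (\<forall>A\<in>carrier_mat n n. T A = \<Phi> A + \<Psi> (transpose_mat A)))"

end

theory Submission
  imports Defs "HOL-Analysis.Convex"
begin

text \<open>
  Both parts use a map \<open>T A = D A - A\<close> with \<open>S = D\<close>, where \<open>D A\<close> is the diagonal matrix with
  entries \<open>\<Sum>l. c i l * A\<^sub>l\<^sub>l\<close> and the coefficients \<open>c i l\<close> are nonnegative. Then \<open>S\<close> is completely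
  positive (\<open>completely_positive_diag_map\<close>), and so is \<open>S - T\<close>, which is the identity map. Only the
  positivity of \<open>T\<close> and the failure of the stronger property depend on \<open>c\<close>.

  Positivity needs to be checked on rank one matrices only, since every positive semidefinite matrix
  is a sum of matrices \<open>w w*\<close> (\<open>psd_sum_rank_one\<close>, by Cholesky elimination). On these it follows from
  the real inequality \<open>(\<Sum>i. a\<^sub>i x\<^sub>i)\<^sup>2 \<le> \<Sum>i. (\<Sum>l. c i l a\<^sub>l\<^sup>2) x\<^sub>i\<^sup>2\<close>
  (\<open>positive_diag_map_minus_id\<close>).

  For part (a), all coefficients are \<open>1\<close>, so \<open>T A = tr(A) 1 - A\<close>, and the inequality is
  Cauchy-Schwarz. With \<open>v = \<Sum>i. e\<^sub>i \<otimes> e\<^sub>i\<close>, applying \<open>I \<otimes> T\<close> to \<open>v v*\<close> gives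
  \<open>1 - v v*\<close>, which is negative at \<open>v\<close>.

  For part (b), \<open>T\<close> is the Choi map. Its positivity is a weighted Cauchy-Schwarz inequality whose
  weights are controlled by \<open>cyclic_ratio_sum_le_one\<close>. It is not decomposable because \<open>I \<otimes> T\<close>
  for a decomposable \<open>T\<close> would preserve positivity of each positive matrix with positive partial
  transpose (\<open>decomposable_amplify_positive\<close>), whereas it does not for \<open>ppt_witness\<close>.
\<close>

section \<open>Hermitian forms of matrices\<close>

text \<open>
  The Hermitian form \<open>v* a v\<close>. Matrices and vectors are given by their entry functions, of which only
  the values at indices below \<open>n\<close> matter.
\<close>

definition quad_form :: "nat \<Rightarrow> (nat \<Rightarrow> nat \<Rightarrow> complex) \<Rightarrow> (nat \<Rightarrow> complex) \<Rightarrow> complex" where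
  "quad_form n a v = (\<Sum>i<n. \<Sum>j<n. a i j * v j * cnj (v i))"

text \<open>
  Positive semidefiniteness; as for \<^const>\<open>positive_mat\<close>, nonnegativity in \<^typ>\<open>complex\<close>
  includes being real.
\<close>

definition psd :: "nat \<Rightarrow> (nat \<Rightarrow> nat \<Rightarrow> complex) \<Rightarrow> bool" where
  "psd n a \<longleftrightarrow> (\<forall>v. 0 \<le> quad_form n a v)"

lemma lessThan_2: "{..<2::nat} = {0, 1}"
  and lessThan_3: "{..<3::nat} = {0, 1, 2}"
  and lessThan_4: "{..<4::nat} = {0, 1, 2, 3}"
  and lessThan_9: "{..<9::nat} = {0, 1, 2, 3, 4, 5, 6, 7, 8}"
  by auto

lemma psdD: "psd n a \<Longrightarrow> 0 \<le> quad_form n a v"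
  by (simp add: psd_def)

lemma quad_form_cong:
  "(\<And>i j. i < n \<Longrightarrow> j < n \<Longrightarrow> a i j = b i j) \<Longrightarrow> (\<And>i. i < n \<Longrightarrow> v i = w i) \<Longrightarrow>
    quad_form n a v = quad_form n b w"
  by (simp add: quad_form_def)

lemma cscalar_prod_eq_quad_form:
  assumes "A \<in> carrier_mat n n" "v \<in> carrier_vec n"
  shows "(A *\<^sub>v v) \<bullet>c v = quad_form n (\<lambda>i j. A $$ (i, j)) (\<lambda>i. v $ i)"
  using assms
  by (auto simp: scalar_prod_def quad_form_def sum_distrib_right atLeast0LessThan
      intro!: sum.cong)

lemma positive_mat_iff_psd:
  "positive_mat n A \<longleftrightarrow> A \<in> carrier_mat n n \<and> psd n (\<lambda>i j. A $$ (i, j))"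
proof -
  have "0 \<le> quad_form n (\<lambda>i j. A $$ (i, j)) v"
    if "positive_mat n A" for v
  proof -
    have "0 \<le> (A *\<^sub>v vec n v) \<bullet>c vec n v"
      using that by (simp add: positive_mat_def)
    also have "\<dots> = quad_form n (\<lambda>i j. A $$ (i, j)) v"
      using that
      by (subst cscalar_prod_eq_quad_form) (auto simp: positive_mat_def intro!: quad_form_cong)
    finally show ?thesis .
  qed
  then show ?thesis
    by (auto simp: positive_mat_def psd_def cscalar_prod_eq_quad_form)
qed

lemma quad_form_diff:
  "quad_form n (\<lambda>i j. a i j - b i j) v = quad_form n a v - quad_form n b v"
  by (simp add: quad_form_def algebra_simps sum_subtractf)

lemma quad_form_sum:
  "quad_form n (\<lambda>i j. \<Sum>r\<in>R. a r i j) v = (\<Sum>r\<in>R. quad_form n (a r) v)"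
proof -
  have "quad_form n (\<lambda>i j. \<Sum>r\<in>R. a r i j) v
      = (\<Sum>i<n. \<Sum>r\<in>R. \<Sum>j<n. a r i j * v j * cnj (v i))"
    unfolding quad_form_def sum_distrib_right by (intro sum.cong refl sum.swap)
  also have "\<dots> = (\<Sum>r\<in>R. quad_form n (a r) v)"
    unfolding quad_form_def by (rule sum.swap)
  finally show ?thesis .
qed

lemma nonneg_mult_cnj: "0 \<le> z * cnj z"
  by (simp add: less_eq_complex_def)

lemma quad_form_rank_one:
  "quad_form n (\<lambda>i j. w i * cnj (w j)) v = (\<Sum>i<n. w i * cnj (v i)) * cnj (\<Sum>i<n. w i * cnj (v i))"
proof -
  have "quad_form n (\<lambda>i j. w i * cnj (w j)) v
      = (\<Sum>i<n. \<Sum>j<n. (w i * cnj (v i)) * cnj (w j * cnj (v j)))"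
    unfolding quad_form_def by (intro sum.cong refl) simp
  then show ?thesis
    by (simp only: sum_product cnj_sum)
qed

lemma psd_rank_one: "psd n (\<lambda>i j. w i * cnj (w j))"
  unfolding psd_def quad_form_rank_one using nonneg_mult_cnj by blast

lemma psd_pair:
  assumes a: "psd n a" and ij: "i < n" "j < n" "i \<noteq> j"
  shows "0 \<le> a i i * (x * cnj x) + a j j * (y * cnj y) + a i j * y * cnj x + a j i * x * cnj y"
proof -
  define v where "v = (\<lambda>k. if k = i then x else if k = j then y else 0)"
  have row: "(\<Sum>l<n. a k l * v l * cnj (v k)) = (a k i * x + a k j * y) * cnj (v k)" for k
  proof -
    have "(\<Sum>l<n. a k l * v l * cnj (v k)) = (\<Sum>l\<in>{i, j}. a k l * v l * cnj (v k))"
      by (rule sum.mono_neutral_right) (use ij in \<open>auto simp: v_def\<close>)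
    then show ?thesis
      using ij by (simp add: v_def algebra_simps)
  qed
  have "quad_form n a v = (\<Sum>k\<in>{i, j}. (a k i * x + a k j * y) * cnj (v k))"
    unfolding quad_form_def row
    by (rule sum.mono_neutral_right) (use ij in \<open>auto simp: v_def\<close>)
  also have "\<dots> = a i i * (x * cnj x) + a j j * (y * cnj y) + a i j * y * cnj x + a j i * x * cnj y"
    using ij by (simp add: v_def algebra_simps)
  finally show ?thesis
    using psdD[OF a, of v] by simp
qed

lemma psd_diag:
  assumes a: "psd n a" and i: "i < n"
  shows "0 \<le> a i i"
proof -
  have row: "(\<Sum>l<n. a k l * (if l = i then 1 else 0) * cnj (if k = i then 1 else 0))
     = (if k = i then a k i else 0)" for k
    using i by (simp add: if_distrib[of "\<lambda>z. _ * z"] if_distrib[of cnj] cong: if_cong)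
  have "quad_form n a (\<lambda>k. if k = i then 1 else 0) = a i i"
    unfolding quad_form_def row using i by simp
  with psdD[OF a] show ?thesis by metis
qed

lemma psd_hermitian:
  assumes a: "psd n a" and ij: "i < n" "j < n"
  shows "a j i = cnj (a i j)"
proof (cases "i = j")
  case True
  with psd_diag[OF a] ij show ?thesis
    by (auto simp: less_eq_complex_def complex_eq_iff)
next
  case False
  show ?thesis
    using psd_diag[OF a ij(1)] psd_diag[OF a ij(2)]
      psd_pair[OF a ij False, of 1 1] psd_pair[OF a ij False, of 1 \<i>]
    by (auto simp: less_eq_complex_def complex_eq_iff)
qed

lemma psd_zero_diag:
  assumes a: "psd n a" and ij: "i < n" "j < n" and z: "a j j = 0"
  shows "a i j = 0"
proof (rule ccontr)
  assume nz: "a i j \<noteq> 0"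
  then have "i \<noteq> j" using z by auto
  define s where "s = (cmod (a i j))\<^sup>2"
  have s: "s > 0" using nz by (simp add: s_def)
  have s_eq: "a i j * cnj (a i j) = complex_of_real s"
    using complex_norm_square[of "a i j"] by (simp add: s_def)
  \<comment> \<open>The form at \<open>e\<^sub>i - t * cnj (a i j) * e\<^sub>j\<close> is \<open>a i i - 2 * t * s\<close>, negative for this \<open>t\<close>.\<close>
  define t where "t = (Re (a i i) + 1) / (2 * s)"
  have "0 \<le> a i i + a i j * (- (of_real t * cnj (a i j)))
      + a j i * cnj (- (of_real t * cnj (a i j)))"
    using psd_pair[OF a ij \<open>i \<noteq> j\<close>, of 1 "- (of_real t * cnj (a i j))"] z by simp
  also have "\<dots> = a i i - 2 * of_real t * (a i j * cnj (a i j))"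
    using psd_hermitian[OF a ij] by (simp add: algebra_simps)
  also have "\<dots> = a i i - of_real (2 * t * s)"
    by (simp add: s_eq)
  finally have "0 \<le> Re (a i i) - 2 * t * s"
    by (simp add: less_eq_complex_def)
  moreover have "2 * t * s = Re (a i i) + 1"
    using s by (simp add: t_def)
  ultimately show False by simp
qed

section \<open>Positive semidefinite matrices are sums of rank one matrices\<close>

text \<open>
  One step of Cholesky elimination: subtracting a suitable rank one matrix clears row and column
  \<open>k\<close>, keeps the matrix positive semidefinite, and does not disturb rows that vanish already.
\<close>

lemma psd_eliminate:
  assumes a: "psd n a" and k: "k < n"
  obtains w where "psd n (\<lambda>i j. a i j - w i * cnj (w j))"
    and "\<And>i. i < n \<Longrightarrow> a i k = w i * cnj (w k)"
    and "\<And>i. a i k = 0 \<Longrightarrow> w i = 0"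
proof -
  define d where "d = Re (a k k)"
  have d: "a k k = of_real d" "d \<ge> 0"
    using psd_diag[OF a k] by (auto simp: d_def less_eq_complex_def complex_eq_iff)
  \<comment> \<open>For \<open>d = 0\<close> this is the zero vector, and column \<open>k\<close> already vanishes.\<close>
  define w where "w = (\<lambda>i. a i k / of_real (sqrt d))"
  have ww: "w i * cnj (w j) = a i k * cnj (a j k) / of_real d" for i j
    using d(2) by (simp add: w_def flip: of_real_mult)
  have wk: "a i k = w i * cnj (w k)" if "i < n" for i
  proof (cases "d = 0")
    case True
    then show ?thesis using psd_zero_diag[OF a that k] d by (simp add: ww)
  next
    case False
    then show ?thesis using d by (simp add: ww)
  qed
  have psd_w: "psd n (\<lambda>i j. a i j - w i * cnj (w j))"
    unfolding psd_def
  proof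
    fix v
    define s where "s = (\<Sum>i<n. a i k * cnj (v i))"
    have s': "cnj s = (\<Sum>j<n. a k j * v j)"
      using psd_hermitian[OF a _ k] by (simp add: s_def)
    define c where "c = cnj s / of_real d"
    define u where "u = (\<lambda>i. if i = k then 1 else 0 :: complex)"
    \<comment> \<open>The new form at \<open>v\<close> is the old one at \<open>v - c * e\<^sub>k\<close>, whose image
      under \<open>a\<close> has \<open>k\<close>-th entry zero.\<close>
    have "quad_form n a (\<lambda>i. v i - c * u i)
      = (\<Sum>i<n. (\<Sum>j<n. a i j * v j) * cnj (v i) - c * (a i k * cnj (v i))
          - cnj c * (if i = k then \<Sum>j<n. a i j * v j else 0)
          + (if i = k then c * cnj c * a k k else 0))"
      unfolding quad_form_def
    proof (rule sum.cong[OF refl])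
      fix i
      have "(\<Sum>j<n. a i j * (v j - c * u j) * cnj (v i - c * u i))
        = ((\<Sum>j<n. a i j * v j) - c * (\<Sum>j<n. a i j * u j)) * cnj (v i - c * u i)"
      proof -
        have "a i j * (v j - c * u j) * z = (a i j * v j - c * (a i j * u j)) * z" for j z
          by (simp add: algebra_simps)
        then show ?thesis
          by (simp only: sum_distrib_right[symmetric] sum_distrib_left[symmetric] sum_subtractf)
      qed
      also have "(\<Sum>j<n. a i j * u j) = a i k"
        using k by (simp add: u_def if_distrib cong: if_cong)
      finally show "(\<Sum>j<n. a i j * (v j - c * u j) * cnj (v i - c * u i))
        = (\<Sum>j<n. a i j * v j) * cnj (v i) - c * (a i k * cnj (v i))
          - cnj c * (if i = k then \<Sum>j<n. a i j * v j else 0)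
          + (if i = k then c * cnj c * a k k else 0)"
        by (auto simp: u_def algebra_simps)
    qed
    also have "\<dots> = quad_form n a v - c * s - cnj c * cnj s + c * cnj c * of_real d"
      using k d(1)
      by (simp only: sum.distrib sum_subtractf sum_distrib_left[symmetric] s_def[symmetric]
          sum.delta finite_lessThan lessThan_iff if_True s'[symmetric])
        (simp add: quad_form_def sum_distrib_right)
    also have "\<dots> = quad_form n a v - s * cnj s / of_real d"
      by (cases "d = 0") (auto simp: c_def)
    also have "s * cnj s / of_real d = quad_form n (\<lambda>i j. w i * cnj (w j)) v"
    proof -
      have "(\<Sum>i<n. w i * cnj (v i)) = s / of_real (sqrt d)"
        by (simp add: w_def s_def sum_divide_distrib)
      then show ?thesis
        using d(2) by (simp add: quad_form_rank_one flip: of_real_mult)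
    qed
    finally show "0 \<le> quad_form n (\<lambda>i j. a i j - w i * cnj (w j)) v"
      using psdD[OF a, of "\<lambda>i. v i - c * u i"] unfolding quad_form_diff by simp
  qed
  have w0: "w i = 0" if "a i k = 0" for i
    using that by (simp add: w_def)
  show thesis
    by (rule that[OF psd_w wk w0])
qed

lemma psd_sum_rank_one:
  assumes a: "psd n a"
  obtains w where "\<And>i j. i < n \<Longrightarrow> j < n \<Longrightarrow> a i j = (\<Sum>r<n. w r i * cnj (w r j))"
proof -
  have "\<exists>w. psd n (\<lambda>i j. a i j - (\<Sum>r<m. w r i * cnj (w r j))) \<and>
      (\<forall>k<m. \<forall>i<n. a i k = (\<Sum>r<m. w r i * cnj (w r k)))"
    if "m \<le> n" for m
    using that
  proof (induction m)
    case 0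
    then show ?case using a by simp
  next
    case (Suc m)
    then obtain w where w: "psd n (\<lambda>i j. a i j - (\<Sum>r<m. w r i * cnj (w r j)))"
      "\<And>k i. k < m \<Longrightarrow> i < n \<Longrightarrow> a i k = (\<Sum>r<m. w r i * cnj (w r k))"
      by auto
    obtain x where x: "psd n (\<lambda>i j. a i j - (\<Sum>r<m. w r i * cnj (w r j)) - x i * cnj (x j))"
      "\<And>i. i < n \<Longrightarrow> a i m - (\<Sum>r<m. w r i * cnj (w r m)) = x i * cnj (x m)"
      "\<And>i. a i m - (\<Sum>r<m. w r i * cnj (w r m)) = 0 \<Longrightarrow> x i = 0"
      using psd_eliminate[OF w(1), of m] Suc.prems by auto
    have x0: "x k = 0" if "k < m" for k
    proof (rule x(3))
      have "a m k - (\<Sum>r<m. w r m * cnj (w r k)) = 0"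
        using w(2)[of k m] that Suc.prems by simp
      then show "a k m - (\<Sum>r<m. w r k * cnj (w r m)) = 0"
        using psd_hermitian[OF w(1), of m k] that Suc.prems by simp
    qed
    define w' where "w' = w(m := x)"
    have w': "(\<Sum>r<Suc m. w' r i * cnj (w' r j))
        = (\<Sum>r<m. w r i * cnj (w r j)) + x i * cnj (x j)" for i j
      by (simp add: w'_def)
    have "a i k = (\<Sum>r<Suc m. w' r i * cnj (w' r k))" if "k < Suc m" "i < n" for i k
      using that w(2)[of k i] x(2)[of i] x0[of k] unfolding w'
      by (cases "k = m") (auto simp: algebra_simps)
    moreover have "psd n (\<lambda>i j. a i j - (\<Sum>r<Suc m. w' r i * cnj (w' r j)))"
      unfolding w' using x(1) by (simp add: algebra_simps)
    ultimately show ?case by blast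
  qed
  from this[of n] that show thesis by auto
qed

section \<open>Maps of the form D - id\<close>

text \<open>
  The map sending \<open>A\<close> to the diagonal matrix with entries \<open>\<Sum>l<n. c i l * A $$ (l, l)\<close>.
\<close>

definition diag_map :: "nat \<Rightarrow> (nat \<Rightarrow> nat \<Rightarrow> real) \<Rightarrow> complex mat \<Rightarrow> complex mat" where
  "diag_map n c A =
    mat n n (\<lambda>(i, j). if i = j then \<Sum>l<n. complex_of_real (c i l) * A $$ (l, l) else 0)"

lemma linear_diag_map: "linear_on_mat n (diag_map n c)"
  by (auto simp: linear_on_mat_def diag_map_def sum.distrib algebra_simps sum_distrib_left
      intro!: eq_matI)

lemma linear_diag_map_minus_id: "linear_on_mat n (\<lambda>A. diag_map n c A - A)"
  by (auto simp: linear_on_mat_def diag_map_def sum.distrib algebra_simps sum_distrib_left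
      intro!: eq_matI)

lemma positive_diag_map_minus_id:
  assumes c: "\<And>a x :: nat \<Rightarrow> real. (\<Sum>i<n. a i * x i)\<^sup>2 \<le> (\<Sum>i<n. (\<Sum>l<n. c i l * (a l)\<^sup>2) * (x i)\<^sup>2)"
  shows "positive_map n (\<lambda>A. diag_map n c A - A)"
  unfolding positive_map_def
proof (intro allI impI)
  fix A assume "positive_mat n A"
  then have A: "A \<in> carrier_mat n n" and "psd n (\<lambda>i j. A $$ (i, j))"
    by (auto simp: positive_mat_iff_psd)
  then obtain w where w: "\<And>i j. i < n \<Longrightarrow> j < n \<Longrightarrow> A $$ (i, j) = (\<Sum>r<n. w r i * cnj (w r j))"
    by (auto elim: psd_sum_rank_one)
  define b where "b = (\<lambda>r i j. (if i = j then \<Sum>l<n. complex_of_real (c i l) * (w r l * cnj (w r l)) else 0)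
     - w r i * cnj (w r j))"
  have "0 \<le> quad_form n (b r) v" for r v
  proof -
    define z where "z = (\<Sum>i<n. w r i * cnj (v i))"
    define a x where "a = (\<lambda>i. cmod (w r i))" and "x = (\<lambda>i. cmod (v i))"
    have "quad_form n (b r) v
       = (\<Sum>i<n. (\<Sum>l<n. complex_of_real (c i l) * (w r l * cnj (w r l))) * (v i * cnj (v i)))
        - z * cnj z"
      unfolding b_def quad_form_diff quad_form_rank_one z_def
      by (simp add: quad_form_def if_distrib[of "\<lambda>z. z * _"] mult.assoc cong: if_cong)
    also have "\<dots> = of_real ((\<Sum>i<n. (\<Sum>l<n. c i l * (a l)\<^sup>2) * (x i)\<^sup>2)
        - (cmod z)\<^sup>2)"
      by (simp add: a_def x_def flip: complex_norm_square)
    finally have eq: "quad_form n (b r) v = \<dots>" .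
    have "cmod z \<le> (\<Sum>i<n. a i * x i)"
      unfolding z_def a_def x_def by (rule sum_norm_le) (simp add: norm_mult)
    then have "(cmod z)\<^sup>2 \<le> (\<Sum>i<n. a i * x i)\<^sup>2"
      by (rule power_mono) simp
    also note c
    finally show ?thesis unfolding eq by (simp add: less_eq_complex_def)
  qed
  then have "0 \<le> (\<Sum>r<n. quad_form n (b r) v)" for v
    by (simp add: sum_nonneg)
  moreover have "quad_form n (\<lambda>i j. (diag_map n c A - A) $$ (i, j)) v = (\<Sum>r<n. quad_form n (b r) v)"
    for v
  proof -
    have "(diag_map n c A - A) $$ (i, j) = (\<Sum>r<n. b r i j)" if "i < n" "j < n" for i j
      using that A
      by (auto simp: diag_map_def b_def w sum_subtractf sum_distrib_left intro: sum.swap)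
    then show ?thesis
      by (simp add: quad_form_sum[symmetric] cong: quad_form_cong)
  qed
  ultimately show "positive_mat n (diag_map n c A - A)"
    using A by (auto simp: positive_mat_iff_psd psd_def)
qed

section \<open>Complete positivity\<close>

lemma block_index_less:
  fixes p k i n :: nat
  assumes "p < k" "i < n"
  shows "p * n + i < k * n"
proof -
  have "p * n + i < Suc p * n" using assms by simp
  also have "\<dots> \<le> k * n" using assms by (intro mult_le_mono1) simp
  finally show ?thesis .
qed

lemma sum_lessThan_times:
  fixes f :: "nat \<Rightarrow> 'a::comm_monoid_add"
  shows "(\<Sum>i<k * n. f i) = (\<Sum>p<k. \<Sum>r<n. f (p * n + r))"
proof -
  have "(\<Sum>i<k * n. f i) = (\<Sum>p<k. sum f {p * n..<p * n + n})"
    by (rule sum.nat_group[symmetric])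
  also have "\<dots> = (\<Sum>p<k. \<Sum>r<n. f (p * n + r))"
    using sum.shift_bounds_nat_ivl[of f 0 "_ * n" n]
    by (simp add: atLeast0LessThan add.commute)
  finally show ?thesis .
qed

lemma amplify_index:
  assumes "p < k" "q < k" "i < n" "j < n"
  shows "amplify k n T A $$ (p * n + i, q * n + j) = T (mat_block n A p q) $$ (i, j)"
  using assms block_index_less[of p k i n] block_index_less[of q k j n] by (simp add: amplify_def)

lemma mat_block_carrier [simp]: "mat_block n A p q \<in> carrier_mat n n"
  by (simp add: mat_block_def)

lemma amplify_cong:
  assumes "\<And>A. A \<in> carrier_mat n n \<Longrightarrow> T A = T' A"
  shows "amplify k n T A = amplify k n T' A"
  using assms by (simp add: amplify_def)

lemma amplify_id:
  assumes "A \<in> carrier_mat (k * n) (k * n)"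
  shows "amplify k n (\<lambda>A. A) A = A"
proof (rule eq_matI)
  fix i j assume ij: "i < dim_row A" "j < dim_col A"
  then have "0 < n" using assms by (cases n) auto
  with ij assms show "amplify k n (\<lambda>A. A) A $$ (i, j) = A $$ (i, j)"
    by (simp add: amplify_def mat_block_def)
qed (use assms in \<open>auto simp: amplify_def\<close>)

lemma completely_positive_id:
  assumes "\<And>A. A \<in> carrier_mat n n \<Longrightarrow> T A = A"
  shows "completely_positive_map n T"
  unfolding completely_positive_map_def k_positive_map_def positive_map_def
  using amplify_cong[OF assms] amplify_id by (auto simp: positive_mat_def)

lemma completely_positive_diag_map:
  assumes c: "\<And>i l. 0 \<le> c i l"
  shows "completely_positive_map n (diag_map n c)"
  unfolding completely_positive_map_def k_positive_map_def positive_map_def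
proof (intro allI impI)
  fix k A assume "positive_mat (k * n) A"
  then have A: "A \<in> carrier_mat (k * n) (k * n)" "psd (k * n) (\<lambda>i j. A $$ (i, j))"
    by (auto simp: positive_mat_iff_psd)
  have "0 \<le> quad_form (k * n) (\<lambda>i j. amplify k n (diag_map n c) A $$ (i, j)) v" for v
  proof -
    \<comment> \<open>\<open>D\<close> is the sum of the maps \<open>A \<mapsto> c r l * E\<^sub>r\<^sub>l A E\<^sub>l\<^sub>r\<close>, and \<open>u r l\<close> is
      \<open>(I \<otimes> E\<^sub>l\<^sub>r) v\<close>.\<close>
    define u where "u = (\<lambda>r l j. if j mod n = l then v (j div n * n + r) else 0)"
    have u: "quad_form (k * n) (\<lambda>i j. A $$ (i, j)) (u r l)
        = (\<Sum>p<k. \<Sum>q<k. A $$ (p * n + l, q * n + l) * v (q * n + r) * cnj (v (p * n + r)))"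
      if "l < n" for r l
    proof -
      have "u r l (p * n + i) = (if i = l then v (p * n + r) else 0)" if "i < n" for p i
        using that by (simp add: u_def)
      moreover have "(\<Sum>i<n. \<Sum>q<k. \<Sum>j<n. g i q j * (if j = l then x q else 0)
            * cnj (if i = l then y else 0)) = (\<Sum>q<k. g l q l * x q * cnj y)"
        for g :: "nat \<Rightarrow> nat \<Rightarrow> nat \<Rightarrow> complex" and x y
      proof -
        have "(\<Sum>j<n. g i q j * (if j = l then x q else 0) * z) = g i q l * x q * z" for i q z
          using that by (simp add: if_distrib[of "\<lambda>z. _ * z"] if_distrib[of "\<lambda>z. z * _"]
              cong: if_cong)
        moreover have "(\<Sum>i<n. \<Sum>q<k. g i q l * x q * cnj (if i = l then y else 0))
          = (\<Sum>i<n. if i = l then \<Sum>q<k. g l q l * x q * cnj y else 0)"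
          by (intro sum.cong refl) auto
        ultimately show ?thesis
          using that by simp
      qed
      ultimately show ?thesis
        unfolding quad_form_def sum_lessThan_times by simp
    qed
    have "quad_form (k * n) (\<lambda>i j. amplify k n (diag_map n c) A $$ (i, j)) v
       = (\<Sum>p<k. \<Sum>r<n. \<Sum>q<k. \<Sum>s<n. (if r = s then \<Sum>l<n. complex_of_real (c r l) * A $$ (p * n + l, q * n + l) else 0)
            * v (q * n + s) * cnj (v (p * n + r)))"
      unfolding quad_form_def sum_lessThan_times
      by (intro sum.cong refl) (simp add: amplify_index diag_map_def mat_block_def)
    also have "\<dots> = (\<Sum>p<k. \<Sum>r<n. \<Sum>q<k. \<Sum>l<n. complex_of_real (c r l) *
        (A $$ (p * n + l, q * n + l) * v (q * n + r) * cnj (v (p * n + r))))"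
      by (simp add: if_distrib[of "\<lambda>z. z * _"] sum_distrib_right mult.assoc cong: if_cong)
    also have "\<dots> = (\<Sum>p<k. \<Sum>r<n. \<Sum>l<n. \<Sum>q<k. complex_of_real (c r l) *
        (A $$ (p * n + l, q * n + l) * v (q * n + r) * cnj (v (p * n + r))))"
      by (intro sum.cong refl sum.swap)
    also have "\<dots> = (\<Sum>r<n. \<Sum>p<k. \<Sum>l<n. \<Sum>q<k. complex_of_real (c r l) *
        (A $$ (p * n + l, q * n + l) * v (q * n + r) * cnj (v (p * n + r))))"
      by (rule sum.swap)
    also have "\<dots> = (\<Sum>r<n. \<Sum>l<n. \<Sum>p<k. \<Sum>q<k. complex_of_real (c r l) *
        (A $$ (p * n + l, q * n + l) * v (q * n + r) * cnj (v (p * n + r))))"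
      by (intro sum.cong refl sum.swap)
    also have "\<dots> = (\<Sum>r<n. \<Sum>l<n. complex_of_real (c r l) *
        quad_form (k * n) (\<lambda>i j. A $$ (i, j)) (u r l))"
      by (simp add: u sum_distrib_left)
    also have "0 \<le> \<dots>"
      using c psdD[OF A(2)] by (intro sum_nonneg mult_nonneg_nonneg) (auto simp: less_eq_complex_def)
    finally show ?thesis .
  qed
  then show "positive_mat (k * n) (amplify k n (diag_map n c) A)"
    by (simp add: positive_mat_iff_psd psd_def) (simp add: amplify_def)
qed

lemma amplify_diag_map_minus_id_index:
  assumes "x < k * n" "y < k * n"
  shows "amplify k n (\<lambda>A. diag_map n c A - A) A $$ (x, y) =
    (if x mod n = y mod n
     then \<Sum>l<n. complex_of_real (c (x mod n) l) * A $$ (x div n * n + l, y div n * n + l) else 0)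
    - A $$ (x, y)"
proof -
  have "0 < n" using assms by (cases n) auto
  then show ?thesis
    using assms by (simp add: amplify_def diag_map_def mat_block_def)
qed

lemma cp_le_diag_map: "cp_le n (\<lambda>A. diag_map n c A - A) (diag_map n c)"
  unfolding cp_le_def
  by (rule completely_positive_id) (auto simp: diag_map_def)

section \<open>Two-positivity fails in dimension two\<close>

text \<open>With these coefficients, \<open>diag_map n trace_coeff A\<close> is the trace of \<open>A\<close> times the identity.\<close>

definition trace_coeff :: "nat \<Rightarrow> nat \<Rightarrow> real" where
  "trace_coeff i l = 1"

lemma positive_trace_minus_id: "positive_map n (\<lambda>A. diag_map n trace_coeff A - A)"
proof (rule positive_diag_map_minus_id)
  fix a x :: "nat \<Rightarrow> real"
  show "(\<Sum>i<n. a i * x i)\<^sup>2 \<le> (\<Sum>i<n. (\<Sum>l<n. trace_coeff i l * (a l)\<^sup>2) * (x i)\<^sup>2)"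
    using Cauchy_Schwarz_ineq_sum[of a x "{..<n}"]
    by (simp add: trace_coeff_def sum_distrib_left)
qed

lemma not_two_positive_trace_minus_id:
  "\<not> k_positive_map 2 2 (\<lambda>A. diag_map 2 trace_coeff A - A)"
proof
  assume pos: "k_positive_map 2 2 (\<lambda>A. diag_map 2 trace_coeff A - A)"
  \<comment> \<open>The vector \<open>\<Sum>i. e\<^sub>i \<otimes> e\<^sub>i\<close>; applying \<open>I \<otimes> T\<close> to \<open>v v*\<close> gives \<open>1 - v v*\<close>.\<close>
  define v :: "nat \<Rightarrow> complex" where "v = (\<lambda>i. if i = 0 \<or> i = 3 then 1 else 0)"
  have quad_form: "quad_form (2 * 2) a v = a 0 0 + a 0 3 + (a 3 0 + a 3 3)" for a
    by (simp add: quad_form_def lessThan_4 v_def)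
  define A where "A = mat (2 * 2) (2 * 2) (\<lambda>(i, j). v i * cnj (v j))"
  have "quad_form (2 * 2) (\<lambda>i j. A $$ (i, j)) x = quad_form (2 * 2) (\<lambda>i j. v i * cnj (v j)) x" for x
    by (rule quad_form_cong) (auto simp: A_def)
  with psd_rank_one[of "2 * 2" v] have "psd (2 * 2) (\<lambda>i j. A $$ (i, j))"
    unfolding psd_def by presburger
  then have "positive_mat (2 * 2) A"
    by (auto simp: positive_mat_iff_psd A_def)
  then have "positive_mat (2 * 2) (amplify 2 2 (\<lambda>A. diag_map 2 trace_coeff A - A) A)"
    using pos by (simp add: k_positive_map_def positive_map_def)
  then have "0 \<le> quad_form (2 * 2)
     (\<lambda>i j. amplify 2 2 (\<lambda>A. diag_map 2 trace_coeff A - A) A $$ (i, j)) v"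
    by (auto simp: positive_mat_iff_psd psd_def)
  also have "\<dots> = -2"
    unfolding quad_form
    by (simp add: amplify_diag_map_minus_id_index lessThan_2 A_def v_def trace_coeff_def)
  finally show False by (simp add: less_eq_complex_def)
qed

section \<open>Decomposable maps and the partial transpose\<close>

text \<open>Each of the \<open>n \<times> n\<close> blocks of \<open>A\<close> is transposed in place.\<close>

definition partial_transpose :: "nat \<Rightarrow> nat \<Rightarrow> complex mat \<Rightarrow> complex mat" where
  "partial_transpose k n A = mat (k * n) (k * n)
    (\<lambda>(i, j). A $$ (i div n * n + j mod n, j div n * n + i mod n))"

lemma mat_block_partial_transpose:
  assumes "p < k" "q < k"
  shows "mat_block n (partial_transpose k n A) p q = transpose_mat (mat_block n A p q)"
  using assms block_index_less[of p k _ n] block_index_less[of q k _ n]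
  by (intro eq_matI) (auto simp: mat_block_def partial_transpose_def)

text \<open>
  Positivity under the partial transpose is the witness against decomposability: a decomposable
  map, applied blockwise, preserves positivity of those positive matrices whose partial transpose
  is positive as well.
\<close>

lemma decomposable_amplify_positive:
  assumes T: "decomposable_map n T"
    and A: "positive_mat (k * n) A" and A': "positive_mat (k * n) (partial_transpose k n A)"
  shows "positive_mat (k * n) (amplify k n T A)"
proof -
  obtain \<Phi> \<Psi> where cp: "completely_positive_map n \<Phi>" "completely_positive_map n \<Psi>"
    and lin: "linear_on_mat n \<Phi>" "linear_on_mat n \<Psi>"
    and T_eq: "\<And>A. A \<in> carrier_mat n n \<Longrightarrow> T A = \<Phi> A + \<Psi> (transpose_mat A)"
    using T by (auto simp: decomposable_map_def)
  have car: "\<Phi> B \<in> carrier_mat n n" "\<Psi> B \<in> carrier_mat n n" if "B \<in> carrier_mat n n" for B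
    using lin that by (auto simp: linear_on_mat_def)
  have "positive_mat (k * n) (amplify k n \<Phi> A)"
    and "positive_mat (k * n) (amplify k n \<Psi> (partial_transpose k n A))"
    using cp A A' by (auto simp: completely_positive_map_def k_positive_map_def positive_map_def)
  then have nonneg: "0 \<le> quad_form (k * n) (\<lambda>i j. amplify k n \<Phi> A $$ (i, j)) v
      + quad_form (k * n) (\<lambda>i j. amplify k n \<Psi> (partial_transpose k n A) $$ (i, j)) v" for v
    by (simp add: positive_mat_iff_psd psd_def)
  have entry: "amplify k n T A $$ (i, j)
      = amplify k n \<Phi> A $$ (i, j) + amplify k n \<Psi> (partial_transpose k n A) $$ (i, j)"
    if "i < k * n" "j < k * n" for i j
  proof -
    have "0 < n" using that by (cases n) auto
    have "i div n < k" "j div n < k"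
      using that by (auto simp: less_mult_imp_div_less)
    then show ?thesis
      using that \<open>0 < n\<close> car[of "mat_block n A (i div n) (j div n)"]
        car[of "transpose_mat (mat_block n A (i div n) (j div n))"]
      by (simp add: amplify_def T_eq mat_block_partial_transpose)
  qed
  have "quad_form (k * n) (\<lambda>i j. amplify k n T A $$ (i, j)) v
      = quad_form (k * n) (\<lambda>i j. amplify k n \<Phi> A $$ (i, j)) v
      + quad_form (k * n) (\<lambda>i j. amplify k n \<Psi> (partial_transpose k n A) $$ (i, j)) v" for v
    by (simp add: quad_form_def entry sum.distrib distrib_right)
  with nonneg show ?thesis
    by (simp add: positive_mat_iff_psd psd_def) (simp add: amplify_def)
qed

section \<open>The Choi map in dimension three\<close>

text \<open>
  With these coefficients, \<open>diag_map 3 choi_coeff A - A\<close> is the Choi map, with diagonal entries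
  \<open>A\<^sub>i\<^sub>i + A\<^sub>i\<^sub>-\<^sub>1\<^sub>,\<^sub>i\<^sub>-\<^sub>1\<close> (indices modulo three) and off-diagonal entries \<open>- A\<^sub>i\<^sub>j\<close>.
\<close>

definition choi_coeff :: "nat \<Rightarrow> nat \<Rightarrow> real" where
  "choi_coeff i l = (if l = i then 2 else if l = (i + 2) mod 3 then 1 else 0)"

text \<open>A weight may vanish where \<open>a\<close> does; the quotient is zero there.\<close>

lemma weighted_Cauchy_Schwarz:
  fixes a d x :: "'a \<Rightarrow> real"
  assumes d: "\<And>i. i \<in> I \<Longrightarrow> 0 \<le> d i" "\<And>i. i \<in> I \<Longrightarrow> d i = 0 \<Longrightarrow> a i = 0"
  shows "(\<Sum>i\<in>I. a i * x i)\<^sup>2 \<le> (\<Sum>i\<in>I. (a i)\<^sup>2 / d i) * (\<Sum>i\<in>I. d i * (x i)\<^sup>2)"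
proof -
  have "(\<Sum>i\<in>I. a i / sqrt (d i) * (sqrt (d i) * x i))\<^sup>2
      \<le> (\<Sum>i\<in>I. (a i / sqrt (d i))\<^sup>2) * (\<Sum>i\<in>I. (sqrt (d i) * x i)\<^sup>2)"
    by (rule Cauchy_Schwarz_ineq_sum)
  moreover have "a i / sqrt (d i) * (sqrt (d i) * x i) = a i * x i" if "i \<in> I" for i
    using d[OF that] by (cases "d i = 0") auto
  ultimately show ?thesis
    using d(1) by (simp add: power_divide power_mult_distrib)
qed

text \<open>The inequality is invariant under cyclic shifts, so the smallest variable may come first.\<close>

lemma cyclic_AM_GM:
  fixes p q r :: real
  assumes "0 \<le> p" "0 \<le> q" "0 \<le> r"
  shows "3 * (p * q * r) \<le> p\<^sup>2 * q + q\<^sup>2 * r + r\<^sup>2 * p"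
proof -
  have *: "3 * (x * y * z) \<le> x\<^sup>2 * y + y\<^sup>2 * z + z\<^sup>2 * x"
    if "0 \<le> x" "x \<le> y" "x \<le> z" for x y z :: real
  proof -
    define s t where "s = y - x" and "t = z - x"
    have yz: "y = x + s" "z = x + t" by (auto simp: s_def t_def)
    have st: "0 \<le> s" "0 \<le> t" using that by (auto simp: s_def t_def)
    have "x\<^sup>2 * y + y\<^sup>2 * z + z\<^sup>2 * x - 3 * (x * y * z) = x * ((s - t)\<^sup>2 + s * t) + s\<^sup>2 * t"
      unfolding yz by (simp add: algebra_simps power2_eq_square)
    also have "0 \<le> \<dots>" using that st by simp
    finally show ?thesis by simp
  qed
  consider "p \<le> q" "p \<le> r" | "q \<le> r" "q \<le> p" | "r \<le> p" "r \<le> q"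
    by linarith
  then show ?thesis
    using *[of p q r] *[of q r p] *[of r p q] assms by cases (auto simp: algebra_simps)
qed

text \<open>
  For positive \<open>p, q, r\<close> this is \<open>\<Sum>i. 1 / (2 + t\<^sub>i) \<le> 1\<close> with \<open>t\<^sub>1 = r / p\<close>,
  \<open>t\<^sub>2 = p / q\<close> and \<open>t\<^sub>3 = q / r\<close>. Since \<open>t\<^sub>1 t\<^sub>2 t\<^sub>3 = 1\<close>, it is equivalent to \<open>t\<^sub>1 t\<^sub>2 + t\<^sub>2 t\<^sub>3 + t\<^sub>3 t\<^sub>1 \<ge> 3\<close>.
  If one variable is zero, then so is its term, and the other two are at most \<open>1 / 2\<close> each. Division
  by zero yields zero here, as needed where weights vanish.
\<close>

lemma cyclic_ratio_sum_le_one: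
  fixes p q r :: real
  assumes "0 \<le> p" "0 \<le> q" "0 \<le> r"
  shows "p / (2 * p + r) + q / (2 * q + p) + r / (2 * r + q) \<le> 1"
proof (cases "p = 0 \<or> q = 0 \<or> r = 0")
  case True
  have half: "x / (2 * x + y) \<le> 1 / 2" if "0 \<le> x" "0 \<le> y" for x y :: real
    using that by (cases "2 * x + y = 0") (auto simp: divide_simps)
  have "p / (2 * p + r) = 0 \<or> q / (2 * q + p) = 0 \<or> r / (2 * r + q) = 0"
    using True by auto
  then show ?thesis
    using half[OF assms(1,3)] half[OF assms(2,1)] half[OF assms(3,2)] by (elim disjE) linarith+
next
  case False
  with assms have pos: "0 < p" "0 < q" "0 < r" by auto
  note amgm = cyclic_AM_GM[OF assms]
  show ?thesis
    using pos amgm by (simp add: divide_simps add_pos_pos) (simp add: algebra_simps power2_eq_square)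
qed

lemma positive_choi_map: "positive_map 3 (\<lambda>A. diag_map 3 choi_coeff A - A)"
proof (rule positive_diag_map_minus_id)
  fix a x :: "nat \<Rightarrow> real"
  define d where "d = (\<lambda>i. \<Sum>l<3. choi_coeff i l * (a l)\<^sup>2)"
  have d_ge: "(a i)\<^sup>2 \<le> d i" if "i < 3" for i
  proof -
    have "(a i)\<^sup>2 \<le> choi_coeff i i * (a i)\<^sup>2" by (simp add: choi_coeff_def)
    also have "\<dots> \<le> d i"
      unfolding d_def using that
      by (intro member_le_sum[of i _ "\<lambda>l. choi_coeff i l * (a l)\<^sup>2"]) (auto simp: choi_coeff_def)
    finally show ?thesis .
  qed
  have "(\<Sum>i<3. a i * x i)\<^sup>2 \<le> (\<Sum>i<3. (a i)\<^sup>2 / d i) * (\<Sum>i<3. d i * (x i)\<^sup>2)"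
  proof (rule weighted_Cauchy_Schwarz)
    fix i :: nat assume "i \<in> {..<3}"
    then have "(a i)\<^sup>2 \<le> d i" by (simp add: d_ge)
    then show "0 \<le> d i" by (rule order_trans[OF zero_le_power2])
    show "a i = 0" if "d i = 0" using \<open>(a i)\<^sup>2 \<le> d i\<close> that by simp
  qed
  also have "\<dots> \<le> 1 * (\<Sum>i<3. d i * (x i)\<^sup>2)"
  proof (rule mult_right_mono)
    show "(\<Sum>i<3. (a i)\<^sup>2 / d i) \<le> 1"
      using cyclic_ratio_sum_le_one[of "(a 0)\<^sup>2" "(a 1)\<^sup>2" "(a 2)\<^sup>2"]
      by (simp add: d_def choi_coeff_def lessThan_3 add_ac)
    show "0 \<le> (\<Sum>i<3. d i * (x i)\<^sup>2)"
      using order_trans[OF zero_le_power2 d_ge] by (intro sum_nonneg mult_nonneg_nonneg) auto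
  qed
  finally show "(\<Sum>i<3. a i * x i)\<^sup>2 \<le> (\<Sum>i<3. (\<Sum>l<3. choi_coeff i l * (a l)\<^sup>2) * (x i)\<^sup>2)"
    by (simp add: d_def)
qed

text \<open>
  The matrix \<open>2 \<Sum>\<^sub>i\<^sub>j E\<^sub>i\<^sub>j \<otimes> E\<^sub>i\<^sub>j + \<Sum>\<^sub>i E\<^sub>i\<^sub>i \<otimes> (4 E\<^sub>i\<^sub>+\<^sub>1\<^sub>,\<^sub>i\<^sub>+\<^sub>1 + E\<^sub>i\<^sub>+\<^sub>2\<^sub>,\<^sub>i\<^sub>+\<^sub>2)\<close>, indices modulo three.
  Row \<open>3 * i + j\<close> belongs to \<open>e\<^sub>i \<otimes> e\<^sub>j\<close>. Under the partial transpose the off-diagonal entries \<open>2\<close>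
  move to the pairs \<open>e\<^sub>i \<otimes> e\<^sub>j\<close>, \<open>e\<^sub>j \<otimes> e\<^sub>i\<close>; the weights \<open>4\<close> and \<open>1\<close> are on these pairs, so that
  the resulting \<open>2 \<times> 2\<close> submatrices are of rank one. The smaller weight is at the entries that the Choi
  map adds to the diagonal positions \<open>e\<^sub>i \<otimes> e\<^sub>i\<close>.
\<close>

definition ppt_witness :: "complex mat" where
  "ppt_witness = mat (3 * 3) (3 * 3) (\<lambda>(x, y).
     (if x div 3 = x mod 3 \<and> y div 3 = y mod 3 then 2 else 0) +
     (if x = y then if x mod 3 = (x div 3 + 1) mod 3 then 4
        else if x mod 3 = (x div 3 + 2) mod 3 then 1 else 0 else 0))"

lemma positive_ppt_witness: "positive_mat (3 * 3) ppt_witness"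
proof -
  have "0 \<le> quad_form 9 (\<lambda>i j. ppt_witness $$ (i, j)) v" for v
  proof -
    have "quad_form 9 (\<lambda>i j. ppt_witness $$ (i, j)) v =
        2 * ((v 0 + v 4 + v 8) * cnj (v 0 + v 4 + v 8)) +
        4 * (v 1 * cnj (v 1)) + 4 * (v 5 * cnj (v 5)) + 4 * (v 6 * cnj (v 6)) +
        v 2 * cnj (v 2) + v 3 * cnj (v 3) + v 7 * cnj (v 7)"
      by (simp add: quad_form_def lessThan_9 ppt_witness_def) (simp add: algebra_simps)
    also have "0 \<le> \<dots>"
      by (intro add_nonneg_nonneg mult_nonneg_nonneg nonneg_mult_cnj)
        (auto simp: less_eq_complex_def)
    finally show ?thesis .
  qed
  then show ?thesis
    by (simp add: positive_mat_iff_psd psd_def) (simp add: ppt_witness_def)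
qed

lemma positive_partial_transpose_ppt_witness:
  "positive_mat (3 * 3) (partial_transpose 3 3 ppt_witness)"
proof -
  have "0 \<le> quad_form 9 (\<lambda>i j. partial_transpose 3 3 ppt_witness $$ (i, j)) v" for v
  proof -
    have "quad_form 9 (\<lambda>i j. partial_transpose 3 3 ppt_witness $$ (i, j)) v =
        2 * (v 0 * cnj (v 0)) + 2 * (v 4 * cnj (v 4)) + 2 * (v 8 * cnj (v 8)) +
        (2 * v 1 + v 3) * cnj (2 * v 1 + v 3) +
        (2 * v 5 + v 7) * cnj (2 * v 5 + v 7) +
        (2 * v 6 + v 2) * cnj (2 * v 6 + v 2)"
      by (simp add: quad_form_def lessThan_9 partial_transpose_def ppt_witness_def)
        (simp add: algebra_simps)
    also have "0 \<le> \<dots>"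
      by (intro add_nonneg_nonneg mult_nonneg_nonneg nonneg_mult_cnj)
        (auto simp: less_eq_complex_def)
    finally show ?thesis .
  qed
  then show ?thesis
    by (simp add: positive_mat_iff_psd psd_def) (simp add: partial_transpose_def)
qed

lemma not_decomposable_choi_map: "\<not> decomposable_map 3 (\<lambda>A. diag_map 3 choi_coeff A - A)"
proof
  assume "decomposable_map 3 (\<lambda>A. diag_map 3 choi_coeff A - A)"
  from decomposable_amplify_positive[OF this positive_ppt_witness
      positive_partial_transpose_ppt_witness]
  have pos: "psd (3 * 3)
      (\<lambda>i j. amplify 3 3 (\<lambda>A. diag_map 3 choi_coeff A - A) ppt_witness $$ (i, j))"
    by (simp only: positive_mat_iff_psd)
  \<comment> \<open>The test vector is \<open>\<Sum>i. e\<^sub>i \<otimes> e\<^sub>i\<close>.\<close>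
  define v :: "nat \<Rightarrow> complex" where "v = (\<lambda>i. if i div 3 = i mod 3 then 1 else 0)"
  have quad_form: "quad_form (3 * 3) a v =
      (a 0 0 + a 0 4 + a 0 8) + (a 4 0 + a 4 4 + a 4 8) + (a 8 0 + a 8 4 + a 8 8)" for a
    by (simp add: quad_form_def lessThan_9 v_def)
  have "0 \<le> quad_form (3 * 3)
      (\<lambda>i j. amplify 3 3 (\<lambda>A. diag_map 3 choi_coeff A - A) ppt_witness $$ (i, j)) v"
    by (rule psdD[OF pos])
  also have "\<dots> = -3"
    unfolding quad_form
    by (simp add: amplify_diag_map_minus_id_index lessThan_3 ppt_witness_def choi_coeff_def)
  finally show False by (simp add: less_eq_complex_def)
qed

theorem proposition3p1p1:
  shows "(\<exists>T S. linear_on_mat 2 T \<and> linear_on_mat 2 S \<and>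
            positive_map 2 T \<and> cp_le 2 T S \<and> completely_positive_map 2 S \<and>
            \<not> k_positive_map 2 2 T) \<and>
         (\<exists>T S. linear_on_mat 3 T \<and> linear_on_mat 3 S \<and>
            positive_map 3 T \<and> cp_le 3 T S \<and> completely_positive_map 3 S \<and>
            \<not> decomposable_map 3 T)"
proof -
  have "completely_positive_map 2 (diag_map 2 trace_coeff)"
    by (rule completely_positive_diag_map) (simp add: trace_coeff_def)
  moreover have "completely_positive_map 3 (diag_map 3 choi_coeff)"
    by (rule completely_positive_diag_map) (simp add: choi_coeff_def)
  ultimately show ?thesis
    using linear_diag_map linear_diag_map_minus_id cp_le_diag_map
      positive_trace_minus_id not_two_positive_trace_minus_id
      positive_choi_map not_decomposable_choi_map
    by blast
qed

end
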